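(* Let $(\mathcal{L},[\cdot,\cdot])$ be a (left or right) Leibniz algebra. Then $(\mathcal{L},[\cdot,\cdot],L_a)$ is hom-associative for all $a$ in the subspace $$HU_n(\mathcal{L})=C(\mathcal{L})\cap Ann_{\mathcal{L}}^l([\mathcal{L},\mathcal{L}])=C(\mathcal{L})\cap Ann_{\mathcal{L}}^r([\mathcal{L},\mathcal{L}])=C(\mathcal{L})\cap Ann_{\mathcal{L}}([\mathcal{L},\mathcal{L}]).$$ Moreover, every element in $HU_n(\mathcal{L})$ is 3-nilpotent.
   Context: A Leibniz algebra $(\mathcal{L},[\cdot,\cdot])$ is a linear space over a field with a bilinear product such that for all $a,b,c$: $[a,[b,c]]=[[a,b],c]+[b,[a,c]]$ (left Leibniz), or $[[a,b],c]=[[a,c],b]+[a,[b,c]]$ (right Leibniz). $L_a\colon x\mapsto[a,x]$. $(\mathcal{L},[\cdot,\cdot],\alpha)$ is hom-associative if $[\alpha(x),[y,z]]=[[x,y],\alpha(z)]$ for all $x,y,z$. $C(\mathcal{L})=\{a\in\mathcal{L}\mid [a,x]=[x,a]\ \forall x\in\mathcal{L}\}$ is the commutative center. $Ann_{\mathcal{L}}^l(S)=\{a\mid [a,s]=0\ \forall s\in S\}$, $Ann_{\mathcal{L}}^r(S)=\{a\mid [s,a]=0\ \forall s\in S\}$, $Ann_{\mathcal{L}}(S)=Ann_{\mathcal{L}}^l(S)\cap Ann_{\mathcal{L}}^r(S)$. With $[x,y,z]_{\mathrm{as}}=[[x,y],z]-[x,[y,z]]$, the nucleus $N(\mathcal{L})=\{a\mid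 [a,x,y]_{\mathrm{as}}=[x,a,y]_{\mathrm{as}}=[x,y,a]_{\mathrm{as}}=0\ \forall x,y\}$, and $[\mathcal{L},\mathcal{L},\mathcal{L}]_{\mathrm{as}}$ the set of all associators, $HU_n(\mathcal{L})$ is defined as $C(\mathcal{L})\cap N(\mathcal{L})\cap Ann_{\mathcal{L}}^l([\mathcal{L},\mathcal{L},\mathcal{L}]_{\mathrm{as}})$. An element $a$ is 3-nilpotent if $[a,[a,a]]=[[a,a],a]=0$.
   Formalization: The equality of HU_n(L) with C(L) ∩ Ann^l([L,L]) is stated only over fields of characteristic different from 2, since it fails for a 6-dimensional Lie algebra in characteristic 2; all other claims hold over every field. *)

theory Defs
  imports Complex_Main
begin

text \<open>
  The underlying linear space is a whole type with scalar multiplication \<open>scale\<close>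
  over an arbitrary field; no finiteness of dimension is assumed.
\<close>

locale bilinear_algebra = vector_space scale
  for scale :: "'k::field \<Rightarrow> 'l::ab_group_add \<Rightarrow> 'l" +
  fixes br :: "'l \<Rightarrow> 'l \<Rightarrow> 'l"
  assumes linear_br_left: "Vector_Spaces.linear scale scale (\<lambda>x. br x y)"
    and linear_br_right: "Vector_Spaces.linear scale scale (\<lambda>y. br x y)"

locale left_leibniz_algebra = bilinear_algebra scale br
  for scale :: "'k::field \<Rightarrow> 'l::ab_group_add \<Rightarrow> 'l" and br :: "'l \<Rightarrow> 'l \<Rightarrow> 'l" +
  assumes left_leibniz: "br a (br b c) = br (br a b) c + br b (br a c)"

locale right_leibniz_algebra = bilinear_algebra scale br
  for scale :: "'k::field \<Rightarrow> 'l::ab_group_add \<Rightarrow> 'l" and br :: "'l \<Rightarrow> 'l \<Rightarrow> 'l" +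
  assumes right_leibniz: "br (br a b) c = br (br a c) b + br a (br b c)"

definition left_mult :: "('l \<Rightarrow> 'l \<Rightarrow> 'l) \<Rightarrow> 'l \<Rightarrow> 'l \<Rightarrow> 'l" where
  "left_mult br a = (\<lambda>x. br a x)"

definition hom_associative :: "('l \<Rightarrow> 'l \<Rightarrow> 'l) \<Rightarrow> ('l \<Rightarrow> 'l) \<Rightarrow> bool" where
  "hom_associative br \<alpha> \<longleftrightarrow> (\<forall>x y z. br (\<alpha> x) (br y z) = br (br x y) (\<alpha> z))"

definition commutative_center :: "('l \<Rightarrow> 'l \<Rightarrow> 'l) \<Rightarrow> 'l set" where
  "commutative_center br = {a. \<forall>x. br a x = br x a}"

definition left_annihilator :: "('l::zero \<Rightarrow> 'l \<Rightarrow> 'l) \<Rightarrow> 'l set \<Rightarrow> 'l set" where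
  "left_annihilator br S = {a. \<forall>s\<in>S. br a s = 0}"

definition right_annihilator :: "('l::zero \<Rightarrow> 'l \<Rightarrow> 'l) \<Rightarrow> 'l set \<Rightarrow> 'l set" where
  "right_annihilator br S = {a. \<forall>s\<in>S. br s a = 0}"

definition annihilator :: "('l::zero \<Rightarrow> 'l \<Rightarrow> 'l) \<Rightarrow> 'l set \<Rightarrow> 'l set" where
  "annihilator br S = left_annihilator br S \<inter> right_annihilator br S"

definition associator :: "('l::minus \<Rightarrow> 'l \<Rightarrow> 'l) \<Rightarrow> 'l \<Rightarrow> 'l \<Rightarrow> 'l \<Rightarrow> 'l" where
  "associator br x y z = br (br x y) z - br x (br y z)"

definition associators :: "('l::minus \<Rightarrow> 'l \<Rightarrow> 'l) \<Rightarrow> 'l set" where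
  "associators br = {associator br x y z | x y z. True}"

definition nucleus :: "('l::{minus,zero} \<Rightarrow> 'l \<Rightarrow> 'l) \<Rightarrow> 'l set" where
  "nucleus br = {a. \<forall>x y. associator br a x y = 0 \<and> associator br x a y = 0
                          \<and> associator br x y a = 0}"

definition HU\<^sub>n :: "('l::{minus,zero} \<Rightarrow> 'l \<Rightarrow> 'l) \<Rightarrow> 'l set" where
  "HU\<^sub>n br = commutative_center br \<inter> nucleus br \<inter> left_annihilator br (associators br)"

text \<open>
  \<open>[L, L]\<close> is the linear span of all products. Replacing it by the bare set of
  products would not change its annihilators.
\<close>

definition derived_algebra ::
    "('k::field \<Rightarrow> 'l::ab_group_add \<Rightarrow> 'l) \<Rightarrow> ('l \<Rightarrow> 'l \<Rightarrow> 'l) \<Rightarrow> 'l set" where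
  "derived_algebra scale br = module.span scale {br x y | x y. True}"

definition three_nilpotent :: "('l::zero \<Rightarrow> 'l \<Rightarrow> 'l) \<Rightarrow> 'l \<Rightarrow> bool" where
  "three_nilpotent br a \<longleftrightarrow> br a (br a a) = 0 \<and> br (br a a) a = 0"

text \<open>
  A pitfall in characteristic 2: the inclusion of \<open>C(L) \<inter> Ann\<^sup>l([L, L])\<close> in
  \<open>HU\<^sub>n(L)\<close> fails there. On a space with basis \<open>a, x, y, p, q, w\<close> take the alternating
  product with \<open>[a, x] = p\<close>, \<open>[a, y] = q\<close>, \<open>[x, q] = [y, p] = w\<close> and all other products of
  basis elements zero. This is a Lie algebra in characteristic 2 in which \<open>a\<close> lies in
  \<open>C(L) \<inter> Ann([L, L])\<close>, but the associator of \<open>y, x, a\<close> is nonzero, so \<open>a\<close> is not in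
  the nucleus.
\<close>

end

theory Submission
  imports Defs
begin

text \<open>
  Write products by juxtaposition. For a commuting element \<open>a\<close> of the nucleus, the Leibniz
  identity that expands \<open>a(xy)\<close> (left case) or \<open>(xy)a\<close> (right case) is a sum of two terms, one
  of which equals the left-hand side by associativity; hence the other term, \<open>x(ay)\<close> or
  \<open>(xa)y\<close>, vanishes. Associativity and commutativity with \<open>a\<close> then spread this to all three
  products \<open>a(xy)\<close>, \<open>(ax)y\<close>, \<open>x(ay)\<close>. Conversely, the vanishing of these products makes every
  associator condition in \<open>HU\<^sub>n\<close> trivial. So, in every characteristic, \<open>HU\<^sub>n\<close> consists of
  the commuting elements that kill every such triple product (\<open>HU_n_left_leibniz\<close>,
  \<open>HU_n_right_leibniz\<close>). From this description it is immediate that \<open>HU\<^sub>n\<close> is a subspace, that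
  both sides of the hom-associativity identity for \<open>L\<^sub>a\<close> are zero, and that \<open>a\<close> is 3-nilpotent.

  For the comparison with annihilators, let \<open>a\<close> commute with everything and annihilate all
  products. One instance of the Leibniz identity gives \<open>(ax)y + x(ay) = 0\<close>, another gives
  \<open>(ax)y = x(ay)\<close>. Therefore \<open>2(ax)y = 0\<close>, and this is the only place where the characteristic
  matters.
\<close>

definition central_triple_annihilator :: "('l::zero \<Rightarrow> 'l \<Rightarrow> 'l) \<Rightarrow> 'l set" where
  "central_triple_annihilator br =
    {a \<in> commutative_center br.
       \<forall>x y. br a (br x y) = 0 \<and> br (br a x) y = 0 \<and> br x (br a y) = 0}"

context bilinear_algebra
begin

lemma br_add_left: "br (x + y) z = br x z + br y z"
  and br_scale_left: "br (scale c x) z = scale c (br x z)"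
  and br_zero_left: "br 0 z = 0"
  using linear_br_left[of z, folded module_hom_iff_linear]
  by (rule module_hom.add module_hom.scale module_hom.zero)+

lemma br_add_right: "br z (x + y) = br z x + br z y"
  and br_scale_right: "br z (scale c x) = scale c (br z x)"
  and br_zero_right: "br z 0 = 0"
  using linear_br_right[of z, folded module_hom_iff_linear]
  by (rule module_hom.add module_hom.scale module_hom.zero)+

lemma br_diff_right: "br z (x - y) = br z x - br z y"
  by (metis add_diff_cancel br_add_right diff_add_cancel)

lemmas br_linear = br_add_left br_scale_left br_zero_left
  br_add_right br_scale_right br_zero_right

lemma subspace_central_triple_annihilator: "subspace (central_triple_annihilator br)"
  by (rule subspaceI)
    (auto simp: central_triple_annihilator_def commutative_center_def br_linear)

lemma left_annihilator_derived_algebra: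
  "left_annihilator br (derived_algebra scale br) = {a. \<forall>x y. br a (br x y) = 0}"
proof (intro equalityI subsetI)
  fix a assume "a \<in> {a. \<forall>x y. br a (br x y) = 0}"
  then have a: "br a (br x y) = 0" for x y by simp
  have "br a s = 0" if "s \<in> span {br x y | x y. True}" for s
    using that
  proof (induction rule: span_induct)
    case base
    show ?case by (rule subspaceI) (auto simp: br_linear)
  next
    case (step s)
    then show ?case using a by auto
  qed
  then show "a \<in> left_annihilator br (derived_algebra scale br)"
    by (auto simp: left_annihilator_def derived_algebra_def)
qed (auto simp: left_annihilator_def derived_algebra_def intro: span_base)

text \<open>
  Exchanging \<open>a\<close> with a neighbour turns each associator that involves \<open>a\<close>, and each product of
  \<open>a\<close> with an associator, into a difference of two vanishing triple products.
\<close>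

lemma central_triple_annihilator_subset_HU_n: "central_triple_annihilator br \<subseteq> HU\<^sub>n br"
proof
  fix a assume "a \<in> central_triple_annihilator br"
  then have comm: "br x a = br a x"
    and van: "br a (br x y) = 0" "br (br a x) y = 0" "br x (br a y) = 0" for x y
    by (auto simp: central_triple_annihilator_def commutative_center_def)
  show "a \<in> HU\<^sub>n br"
    using van
    by (auto simp: HU\<^sub>n_def commutative_center_def nucleus_def left_annihilator_def
        associators_def associator_def comm br_diff_right)
qed

text \<open>
  The two hypotheses on \<open>a\<close> are what remains of the Leibniz identity, left or right, when
  \<open>a\<close> commutes with everything and annihilates all products.
\<close>

lemma central_triple_annihilatorI:
  assumes char: "(2::'k) \<noteq> 0"
    and a: "a \<in> commutative_center br" "\<And>x y. br a (br x y) = 0"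
    and sum: "\<And>x y. br (br a x) y + br x (br a y) = 0"
    and eq: "\<And>x y. br (br a x) y = br x (br a y)"
  shows "a \<in> central_triple_annihilator br"
proof -
  have "br x (br a y) = 0" for x y
  proof -
    have "scale 2 (br x (br a y)) = br x (br a y) + br x (br a y)"
      by (metis one_add_one scale_left_distrib scale_one)
    also have "\<dots> = 0"
      using sum[of x y] by (simp add: eq)
    finally show ?thesis
      using char by simp
  qed
  then show ?thesis
    using a eq by (simp add: central_triple_annihilator_def)
qed

end

lemma (in left_leibniz_algebra) HU_n_left_leibniz: "HU\<^sub>n br = central_triple_annihilator br"
proof (intro equalityI subsetI)
  fix a assume "a \<in> HU\<^sub>n br"
  then have C: "a \<in> commutative_center br" and comm: "br x a = br a x"
    and nuc: "br (br a x) y = br a (br x y)" "br (br x a) y = br x (br a y)" for x y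
    by (auto simp: HU\<^sub>n_def commutative_center_def nucleus_def associator_def)
  have "br x (br a y) = 0" for x y
    using left_leibniz[of a x y] nuc(1)[of x y] by simp
  then show "a \<in> central_triple_annihilator br"
    using C nuc comm by (simp add: central_triple_annihilator_def)
qed (use central_triple_annihilator_subset_HU_n in blast)

lemma (in right_leibniz_algebra) HU_n_right_leibniz: "HU\<^sub>n br = central_triple_annihilator br"
proof (intro equalityI subsetI)
  fix a assume "a \<in> HU\<^sub>n br"
  then have C: "a \<in> commutative_center br" and comm: "br x a = br a x"
    and nuc: "br (br a x) y = br a (br x y)" "br (br x a) y = br x (br a y)"
      "br (br x y) a = br x (br y a)" for x y
    by (auto simp: HU\<^sub>n_def commutative_center_def nucleus_def associator_def)
  have "br (br x a) y = 0" for x y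
    using right_leibniz[of x y a] nuc(3)[of x y] by simp
  then show "a \<in> central_triple_annihilator br"
    using C nuc comm by (simp add: central_triple_annihilator_def)
qed (use central_triple_annihilator_subset_HU_n in blast)

lemma (in left_leibniz_algebra) central_annihilator_left_leibniz:
  assumes "(2::'k) \<noteq> 0" "a \<in> commutative_center br" "\<And>x y. br a (br x y) = 0"
  shows "a \<in> central_triple_annihilator br"
proof (rule central_triple_annihilatorI)
  fix x y
  show "br (br a x) y + br x (br a y) = 0"
    using left_leibniz[of a x y] assms(3) by simp
  \<comment> \<open>Moving \<open>x\<close> past \<open>a\<close> costs only \<open>a(xy)\<close>, which vanishes.\<close>
  show "br (br a x) y = br x (br a y)"
    using left_leibniz[of x a y] assms(2,3) by (simp add: commutative_center_def)
qed (use assms in auto)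

lemma (in right_leibniz_algebra) central_annihilator_right_leibniz:
  assumes "(2::'k) \<noteq> 0" "a \<in> commutative_center br" "\<And>x y. br a (br x y) = 0"
  shows "a \<in> central_triple_annihilator br"
proof (rule central_triple_annihilatorI)
  have comm: "br x a = br a x" for x
    using assms(2) by (simp add: commutative_center_def)
  fix x y
  show "br (br a x) y + br x (br a y) = 0"
    using right_leibniz[of x y a] assms(3) by (simp add: comm)
  show "br (br a x) y = br x (br a y)"
    using right_leibniz[of x a y] assms(3) by (simp add: comm)
qed (use assms in auto)

theorem proposition72:
  fixes scale :: "'k::field \<Rightarrow> 'l::ab_group_add \<Rightarrow> 'l"
    and br :: "'l \<Rightarrow> 'l \<Rightarrow> 'l"
  assumes "left_leibniz_algebra scale br \<or> right_leibniz_algebra scale br"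
  shows "module.subspace scale (HU\<^sub>n br)
    \<and> (\<forall>a\<in>HU\<^sub>n br. hom_associative br (left_mult br a))
    \<and> ((2::'k) \<noteq> 0 \<longrightarrow>
         HU\<^sub>n br = commutative_center br \<inter> left_annihilator br (derived_algebra scale br))
    \<and> commutative_center br \<inter> left_annihilator br (derived_algebra scale br)
         = commutative_center br \<inter> right_annihilator br (derived_algebra scale br)
    \<and> commutative_center br \<inter> right_annihilator br (derived_algebra scale br)
         = commutative_center br \<inter> annihilator br (derived_algebra scale br)
    \<and> (\<forall>a\<in>HU\<^sub>n br. three_nilpotent br a)"
proof -
  interpret bilinear_algebra scale br
    using assms by (auto simp: left_leibniz_algebra_def right_leibniz_algebra_def)
  have HU: "HU\<^sub>n br = central_triple_annihilator br"
    using assms left_leibniz_algebra.HU_n_left_leibniz right_leibniz_algebra.HU_n_right_leibniz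
    by blast
  have sub: "subspace (HU\<^sub>n br)"
    by (simp add: HU subspace_central_triple_annihilator)
  have hom: "\<forall>a\<in>HU\<^sub>n br. hom_associative br (left_mult br a)"
    by (simp add: HU central_triple_annihilator_def hom_associative_def left_mult_def)
  have nil: "\<forall>a\<in>HU\<^sub>n br. three_nilpotent br a"
    by (simp add: HU central_triple_annihilator_def three_nilpotent_def)
  have ann: "HU\<^sub>n br = commutative_center br \<inter> left_annihilator br (derived_algebra scale br)"
    if char: "(2::'k) \<noteq> 0"
  proof -
    have "a \<in> central_triple_annihilator br"
      if "a \<in> commutative_center br" "\<And>x y. br a (br x y) = 0" for a
      using assms char that left_leibniz_algebra.central_annihilator_left_leibniz
        right_leibniz_algebra.central_annihilator_right_leibniz by metis
    then show ?thesis
      unfolding HU left_annihilator_derived_algebra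
      by (auto simp: central_triple_annihilator_def)
  qed
  have left_right: "commutative_center br \<inter> left_annihilator br S
      = commutative_center br \<inter> right_annihilator br S" for S
    by (auto simp: commutative_center_def left_annihilator_def right_annihilator_def)
  then have right_both: "commutative_center br \<inter> right_annihilator br S
      = commutative_center br \<inter> annihilator br S" for S
    unfolding annihilator_def by blast
  show ?thesis
    using sub hom nil ann left_right right_both by simp
qed

end
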